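(* Let $m,n,q\geq 1$ be integers and $d=m+n+q-1$. (1) For $n=1$, $d\geq 2$, and for $n=2$, $d\geq 3$, any sign pattern $\Sigma_{m,n,q}$ is realizable with the pair $(0,d-2)$. (2) For $n=3$ and $d\geq 5$, any sign pattern $\Sigma_{m,3,q}$ is realizable with the pair $(0,d-2)$. For $d=4$, the sign pattern $\Sigma_{1,3,1}$ is not realizable with the pair $(0,2)$. (3) For $n=4$, the sign pattern $\Sigma_{m,4,q}$ is realizable with the pair $(0,d-2)$ if $q\geq 3$, $m\geq 3$ and $d\geq 10$, or if $m=2$ and $q\geq 6$ (hence $d\geq 11$). (4) For $m=1$ and $n\geq 4$, the sign pattern $\Sigma_{1,n,q}$ is not realizable with the pair $(0,d-2)$.
   Context: A sign pattern of length $d+1$ is a sequence of $d+1$ signs $+$ or $-$ beginning with a $+$. A real polynomial $P=x^d+a_{d-1}x^{d-1}+\cdots+a_1x+a_0$ with all $a_j\neq 0$ defines the sign pattern $(+,\mathrm{sgn}(a_{d-1}),\ldots,\mathrm{sgn}(a_1),\mathrm{sgn}(a_0))$. For integers $m,n,q\geq 1$ with $m+n+q=d+1$, $\Sigma_{m,n,q}$ denotes the sign pattern consisting of $m$ pluses followed by $n$ minuses followed by $q$ pluses. A sign pattern is realizable with a pair $(pos,neg)$ if there is a monic real polynomial of degree $d$ defining this sign pattern which has exactly $pos$ positive roots, all distinct (simple), and exactly $neg$ negative roots, all distinct (simple); the remaining roots are non-real. *)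

theory Defs
  imports Complex_Main "HOL-Computational_Algebra.Polynomial"
begin

text \<open>Signs are the real numbers \<open>1\<close> and \<open>- 1\<close>, i.e. the values of \<^const>\<open>sgn\<close> on nonzero reals.\<close>

definition is_sign_pattern :: "nat \<Rightarrow> real list \<Rightarrow> bool" where
  "is_sign_pattern d \<sigma> \<longleftrightarrow> length \<sigma> = d + 1 \<and> set \<sigma> \<subseteq> {1, - 1} \<and> hd \<sigma> = 1"

text \<open>Signs of the coefficients in order of descending degree; \<^const>\<open>coeffs\<close> lists them ascending.\<close>

definition defines_sign_pattern :: "real poly \<Rightarrow> real list \<Rightarrow> bool" where
  "defines_sign_pattern p \<sigma> \<longleftrightarrow>
     (\<forall>j \<le> degree p. coeff p j \<noteq> 0) \<and> map sgn (rev (coeffs p)) = \<sigma>"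

definition Sigma_pattern :: "nat \<Rightarrow> nat \<Rightarrow> nat \<Rightarrow> real list" where
  "Sigma_pattern m n q = replicate m 1 @ replicate n (- 1) @ replicate q 1"

text \<open>
  The number of real roots is prescribed exactly, so all remaining complex roots are automatically
  non-real (\<open>0\<close> is not a root since the constant coefficient is nonzero).
\<close>

definition realizable :: "real list \<Rightarrow> nat \<times> nat \<Rightarrow> bool" where
  "realizable \<sigma> = (\<lambda>(pos, neg).
     \<exists>p :: real poly. lead_coeff p = 1 \<and> degree p + 1 = length \<sigma> \<and> defines_sign_pattern p \<sigma> \<and>
       card {x. x > 0 \<and> poly p x = 0} = pos \<and>
       card {x. x < 0 \<and> poly p x = 0} = neg \<and>
       (\<forall>x. poly p x = 0 \<longrightarrow> order x p = 1))"

lemma is_sign_pattern_Sigma_pattern: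
  assumes "m \<ge> 1"
  shows "is_sign_pattern (m + n + q - 1) (Sigma_pattern m n q)"
  using assms by (cases m) (auto simp: is_sign_pattern_def Sigma_pattern_def)

end

theory Submission
  imports Defs
begin

text \<open>
  A polynomial realizing a pattern of length \<open>N + 3\<close> with the pair \<open>(0, N)\<close> is
  \<open>(x\<^sup>2 - u x + v) \<Prod>(x + a)\<close> with \<open>u\<^sup>2 < 4 v\<close> and \<open>N\<close> distinct \<open>a > 0\<close>.
  Multiplying it by \<open>x + a\<close> with \<open>a\<close> very small (very large) appends (prepends) a sign to the pattern,
  so for realizability finitely many explicit polynomials suffice.

  For the impossibility when \<open>m = 1\<close> and \<open>n \<ge> 4\<close>, let \<open>e\<^sub>k\<close> be the elementary symmetric functions of the
  \<open>a\<close>. The second and the fifth coefficient are \<open>e\<^sub>1 - u\<close> and \<open>e\<^sub>4 - u e\<^sub>3 + v e\<^sub>2\<close>; both being negative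
  contradicts \<open>e\<^sub>1\<^sup>2 e\<^sub>2 - 4 e\<^sub>1 e\<^sub>3 + 4 e\<^sub>4 \<ge> 0\<close>, because \<open>u\<^sup>2 e\<^sub>2 - 4 u e\<^sub>3 + 4 e\<^sub>4\<close> increases in \<open>u\<close>
  from \<open>u = e\<^sub>1\<close> on.
\<close>

section \<open>Polynomials with two non-real roots\<close>

text \<open>\<open>A\<close> is meant to hold the moduli of the negative roots; being a set, it
  makes them distinct. \<open>u\<close> and \<open>v\<close> are the sum and the product of the
  remaining two roots, a non-real pair iff \<open>u\<^sup>2 < 4 * v\<close>.\<close>

definition two_nonreal :: "real set \<Rightarrow> real \<Rightarrow> real \<Rightarrow> real poly" where
  "two_nonreal A u v = [:v, - u, 1:] * (\<Prod>a\<in>A. [:a, 1:])"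

lemma degree_prod_linear: "finite A \<Longrightarrow> degree (\<Prod>a\<in>A. [:a, 1::real:]) = card A"
  by (subst degree_prod_eq_sum_degree) auto

lemma lead_coeff_prod_linear: "lead_coeff (\<Prod>a\<in>A. [:a, 1::real:]) = 1"
  by (simp add: lead_coeff_prod)

lemma prod_linear_neq_0: "(\<Prod>a\<in>A. [:a, 1::real:]) \<noteq> 0"
  using lead_coeff_prod_linear[of A] by (metis coeff_0 zero_neq_one)

lemma degree_two_nonreal: "finite A \<Longrightarrow> degree (two_nonreal A u v) = card A + 2"
  unfolding two_nonreal_def
  by (subst degree_mult_eq) (auto simp: degree_prod_linear prod_linear_neq_0)

lemma lead_coeff_two_nonreal: "lead_coeff (two_nonreal A u v) = 1"
  unfolding two_nonreal_def by (subst lead_coeff_mult) (simp add: lead_coeff_prod_linear)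

lemma two_nonreal_neq_0: "two_nonreal A u v \<noteq> 0"
  using lead_coeff_two_nonreal[of A u v] by (metis coeff_0 zero_neq_one)

lemma two_nonreal_insert:
  "finite A \<Longrightarrow> a \<notin> A \<Longrightarrow> two_nonreal (insert a A) u v = [:a, 1:] * two_nonreal A u v"
  by (simp add: two_nonreal_def mult.left_commute del: mult_pCons_left)

lemma quadratic_pos:
  fixes u v x :: real
  assumes "u\<^sup>2 < 4 * v"
  shows "v - u * x + x\<^sup>2 > 0"
proof -
  have "4 * (v - u * x + x\<^sup>2) = (2 * x - u)\<^sup>2 + (4 * v - u\<^sup>2)"
    by (simp add: power2_eq_square algebra_simps)
  also have "\<dots> > 0" using assms by (intro add_nonneg_pos) simp_all
  finally show ?thesis by simp
qed

lemma poly_two_nonreal_eq_0_iff: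
  assumes "finite A" "u\<^sup>2 < 4 * v"
  shows "poly (two_nonreal A u v) x = 0 \<longleftrightarrow> - x \<in> A"
proof -
  have "poly [:v, - u, 1:] x \<noteq> 0"
    using quadratic_pos[OF assms(2), of x] by (simp add: power2_eq_square algebra_simps)
  then have "poly (two_nonreal A u v) x = 0 \<longleftrightarrow> (\<exists>a\<in>A. a + x = 0)"
    using assms(1) unfolding two_nonreal_def poly_mult mult_eq_0_iff by (simp add: poly_prod)
  then show ?thesis by (metis add.right_inverse add.commute minus_unique)
qed

lemma order_two_nonreal:
  assumes "finite A" "u\<^sup>2 < 4 * v" "a \<in> A"
  shows "order (- a) (two_nonreal A u v) = 1"
proof -
  let ?p = "two_nonreal (A - {a}) u v"
  have eq: "two_nonreal A u v = [:a, 1:] * ?p"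
    using two_nonreal_insert[of "A - {a}" a u v] assms by (simp add: insert_absorb)
  have "order (- a) ?p = 0"
    using poly_two_nonreal_eq_0_iff[of "A - {a}" u v "- a"] assms by (simp add: order_root)
  moreover have "order (- a) [:a, 1:] = 1"
    using order_power_n_n[of "- a" 1] by simp
  ultimately show ?thesis
    using order_mult[of "[:a, 1:]" ?p "- a"] two_nonreal_neq_0[of A u v] by (simp add: eq)
qed

text \<open>The linear factors split off so far do not vanish at a new root, so the cofactor
  must.\<close>

lemma prod_roots_dvd:
  fixes p :: "real poly"
  assumes "finite A" "\<And>a. a \<in> A \<Longrightarrow> poly p (- a) = 0"
  shows "(\<Prod>a\<in>A. [:a, 1:]) dvd p"
  using assms
proof (induction A rule: finite_induct)
  case (insert a A)
  then obtain q where q: "p = (\<Prod>a\<in>A. [:a, 1:]) * q" by auto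
  have "poly (\<Prod>a\<in>A. [:a, 1:]) (- a) \<noteq> 0"
    using insert.hyps by (auto simp: poly_prod)
  then have "poly q (- a) = 0"
    using insert.prems[of a] q by simp
  then have "[:a, 1:] dvd q" by (simp add: poly_eq_0_iff_dvd)
  then have "[:a, 1:] * (\<Prod>a\<in>A. [:a, 1:]) dvd q * (\<Prod>a\<in>A. [:a, 1:])"
    by (rule mult_dvd_mono) simp
  then show ?case using insert.hyps q by (simp add: mult.commute del: mult_pCons_left)
qed simp

text \<open>Dividing a realizing polynomial, of degree \<open>N + 2\<close>, by the linear factors
  of its \<open>N\<close> negative roots leaves a monic quadratic without real roots.\<close>

lemma realizable_0_iff:
  assumes len: "length \<sigma> = N + 3"
  shows "realizable \<sigma> (0, N) \<longleftrightarrow> (\<exists>A u v. finite A \<and> A \<subseteq> {0<..} \<and> card A = N \<and> u\<^sup>2 < 4 * v \<and>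
    defines_sign_pattern (two_nonreal A u v) \<sigma>)"
proof
  assume "realizable \<sigma> (0, N)"
  then obtain p :: "real poly" where monic: "lead_coeff p = 1"
    and deg: "degree p + 1 = length \<sigma>" and pat: "defines_sign_pattern p \<sigma>"
    and pos: "card {x. x > 0 \<and> poly p x = 0} = 0"
    and neg: "card {x. x < 0 \<and> poly p x = 0} = N"
    and simple: "\<And>x. poly p x = 0 \<Longrightarrow> order x p = 1"
    unfolding realizable_def by auto
  have p0: "p \<noteq> 0" using monic by auto
  have fin: "finite {x. P x \<and> poly p x = 0}" for P
    by (rule finite_subset[OF _ poly_roots_finite[OF p0]]) auto
  have no_pos: "poly p x \<noteq> 0" if "x > 0" for x
    using pos fin[of "\<lambda>x. x > 0"] that by auto
  have "coeff p 0 \<noteq> 0" using pat by (auto simp: defines_sign_pattern_def)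
  then have no_0: "poly p 0 \<noteq> 0" by (simp add: poly_0_coeff_0)
  define A where "A = uminus ` {x. x < 0 \<and> poly p x = 0}"
  have A: "finite A" "A \<subseteq> {0<..}" "card A = N"
    using fin[of "\<lambda>x. x < 0"] neg by (auto simp: A_def card_image)
  have root: "poly p (- a) = 0" if "a \<in> A" for a using that by (auto simp: A_def)
  let ?l = "\<Prod>a\<in>A. [:a, 1::real:]"
  obtain q where q: "p = q * ?l"
    using prod_roots_dvd[OF A(1) root] by (metis dvdE mult.commute)
  have q0: "q \<noteq> 0" using p0 q by auto
  have "degree p = degree q + N"
    using A by (simp add: q degree_mult_eq q0 prod_linear_neq_0 degree_prod_linear)
  then have dq: "degree q = 2" using deg len by simp
  have "coeff q 2 = 1"
    using monic by (simp add: q lead_coeff_mult lead_coeff_prod_linear dq)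
  moreover define v u where "v = coeff q 0" and "u = - coeff q 1"
  ultimately have q_eq: "q = [:v, - u, 1:]"
    using dq by (intro poly_eqI)
      (auto simp: coeff_pCons numeral_2_eq_2 split: nat.splits intro!: coeff_eq_0)
  \<comment> \<open>A real root of \<open>q\<close> would be negative, hence already listed in
    \<open>A\<close>, hence at least double in \<open>p\<close>, against simplicity.\<close>
  have no_root: "poly q x \<noteq> 0" for x
  proof
    assume qx: "poly q x = 0"
    then have px: "poly p x = 0" by (simp add: q)
    then have "x < 0" using no_pos[of x] no_0 by (cases x "0::real" rule: linorder_cases) auto
    then have "- x \<in> A" using px by (auto simp: A_def)
    then have "poly ?l x = 0" using A(1) by (force simp: poly_prod)
    then have "order x q \<ge> 1" "order x ?l \<ge> 1"
      using qx q0 prod_linear_neq_0[of A] by (auto simp: order_root Suc_le_eq)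
    then have "order x p \<ge> 2" using order_mult[of q ?l x] p0 q by simp
    then show False using simple[OF px] by simp
  qed
  have "u\<^sup>2 < 4 * v"
  proof (rule ccontr)
    assume "\<not> u\<^sup>2 < 4 * v"
    then have "(sqrt (u\<^sup>2 - 4 * v))\<^sup>2 = u\<^sup>2 - 4 * v" by simp
    then have "poly q ((u + sqrt (u\<^sup>2 - 4 * v)) / 2) = 0"
      by (simp add: q_eq field_simps power2_eq_square)
    then show False using no_root by blast
  qed
  moreover have "p = two_nonreal A u v" by (simp add: q q_eq two_nonreal_def)
  ultimately show "\<exists>A u v. finite A \<and> A \<subseteq> {0<..} \<and> card A = N \<and> u\<^sup>2 < 4 * v \<and>
      defines_sign_pattern (two_nonreal A u v) \<sigma>"
    using A pat by blast
next
  assume "\<exists>A u v. finite A \<and> A \<subseteq> {0<..} \<and> card A = N \<and> u\<^sup>2 < 4 * v \<and>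
      defines_sign_pattern (two_nonreal A u v) \<sigma>"
  then obtain A u v where A: "finite A" "A \<subseteq> {0<..}" "card A = N" and uv: "u\<^sup>2 < 4 * v"
    and pat: "defines_sign_pattern (two_nonreal A u v) \<sigma>" by blast
  note roots = poly_two_nonreal_eq_0_iff[OF A(1) uv]
  have "card {x. x > 0 \<and> poly (two_nonreal A u v) x = 0} = 0"
    using A(2) by (fastforce simp: roots card_eq_0_iff)
  moreover have "{x. x < 0 \<and> poly (two_nonreal A u v) x = 0} = uminus ` A"
    using A(2) by (force simp: roots)
  then have "card {x. x < 0 \<and> poly (two_nonreal A u v) x = 0} = N"
    using A(3) by (simp add: card_image)
  moreover have "order x (two_nonreal A u v) = 1" if "poly (two_nonreal A u v) x = 0" for x
    using order_two_nonreal[OF A(1) uv, of "- x"] that by (simp add: roots)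
  ultimately show "realizable \<sigma> (0, N)"
    unfolding realizable_def prod.case using A pat len lead_coeff_two_nonreal[of A u v]
    by (intro exI[of _ "two_nonreal A u v"]) (simp add: degree_two_nonreal)
qed

section \<open>Sign patterns with at most two sign changes\<close>

lemma length_Sigma_pattern [simp]: "length (Sigma_pattern m n q) = m + n + q"
  by (simp add: Sigma_pattern_def)

text \<open>Degrees count from the right end of the pattern, so the minuses occupy the degrees from
  \<open>q\<close> to \<open>q + n - 1\<close>.\<close>

lemma defines_Sigma_pattern_iff:
  "defines_sign_pattern p (Sigma_pattern m n q) \<longleftrightarrow> degree p + 1 = m + n + q \<and>
     (\<forall>j \<le> degree p. sgn (coeff p j) = (if q \<le> j \<and> j < q + n then - 1 else 1))"
  (is "?L \<longleftrightarrow> ?d \<and> ?R")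
proof (cases "p = 0")
  case True
  then show ?thesis by (simp add: defines_sign_pattern_def)
next
  case False
  have len: "length (coeffs p) = degree p + 1" using False by (simp add: length_coeffs_degree)
  have nth: "rev (Sigma_pattern m n q) ! j = (if q \<le> j \<and> j < q + n then - 1 else 1)"
    if "j < m + n + q" for j
    using that by (auto simp: Sigma_pattern_def nth_append)
  have "map sgn (rev (coeffs p)) = Sigma_pattern m n q
      \<longleftrightarrow> map sgn (coeffs p) = rev (Sigma_pattern m n q)"
    by (metis rev_map rev_rev_ident)
  also have "\<dots> \<longleftrightarrow> ?d \<and> ?R"
    unfolding list_eq_iff_nth_eq length_map length_rev length_Sigma_pattern len
    by (intro conj_cong refl all_cong1 imp_cong)
      (auto simp: nth len coeffs_nth[OF False])
  finally show ?thesis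
    by (auto simp: defines_sign_pattern_def)
qed

text \<open>With \<open>d = m + n + q - 1\<close> the pair is \<open>(0, d - 2)\<close>.\<close>

definition realizable_Sigma :: "nat \<Rightarrow> nat \<Rightarrow> nat \<Rightarrow> bool" where
  "realizable_Sigma m n q \<longleftrightarrow> realizable (Sigma_pattern m n q) (0, m + n + q - 3)"

lemma realizable_Sigma_iff:
  assumes "m \<ge> 1" "n \<ge> 1" "q \<ge> 1"
  shows "realizable_Sigma m n q \<longleftrightarrow> (\<exists>A u v. finite A \<and> A \<subseteq> {0<..} \<and> card A + 3 = m + n + q \<and>
    u\<^sup>2 < 4 * v \<and> defines_sign_pattern (two_nonreal A u v) (Sigma_pattern m n q))"
proof -
  have "card A = m + n + q - 3 \<longleftrightarrow> card A + 3 = m + n + q" for A :: "real set"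
    using assms by linarith
  then show ?thesis
    using assms unfolding realizable_Sigma_def by (subst realizable_0_iff) auto
qed

section \<open>Attaching a negative root of very small or very large modulus\<close>

lemma sgn_eventually_eq:
  fixes f :: "real \<Rightarrow> real"
  assumes "(f \<longlongrightarrow> l) F" "l \<noteq> 0"
  shows "\<forall>\<^sub>F x in F. sgn (f x) = sgn l"
proof (cases "l > 0")
  case True
  then show ?thesis using order_tendstoD(1)[OF assms(1), of 0] by (auto elim: eventually_mono)
next
  case False
  then have "l < 0" using assms(2) by simp
  then show ?thesis using order_tendstoD(2)[OF assms(1), of 0] by (auto elim: eventually_mono)
qed

text \<open>Coefficient \<open>Suc j\<close> of \<open>(x + e) p\<close> is
  \<open>e * coeff p (Suc j) + coeff p j\<close>, which tends to \<open>coeff p j\<close> as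
  \<open>e\<close> decreases to 0. So all signs move up one degree, and the new constant term
  \<open>e * coeff p 0\<close> is a further plus.\<close>

lemma realizable_Sigma_Suc_right:
  assumes pos: "m \<ge> 1" "n \<ge> 1" "q \<ge> 1" and "realizable_Sigma m n q"
  shows "realizable_Sigma m n (Suc q)"
proof -
  obtain A u v where A: "finite A" "A \<subseteq> {0<..}" "card A + 3 = m + n + q" and uv: "u\<^sup>2 < 4 * v"
    and pat: "defines_sign_pattern (two_nonreal A u v) (Sigma_pattern m n q)"
    using assms by (auto simp: realizable_Sigma_iff)
  define p where "p = two_nonreal A u v"
  have deg: "degree p + 1 = m + n + q"
    and sg: "\<And>j. j \<le> degree p \<Longrightarrow> sgn (coeff p j) = (if q \<le> j \<and> j < q + n then - 1 else 1)"
    using pat by (auto simp: defines_Sigma_pattern_iff p_def)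
  have nz: "coeff p j \<noteq> 0" if "j \<le> degree p" for j
    using sg[OF that] by (auto split: if_splits)
  have "\<forall>\<^sub>F e in at_right 0. sgn (e * coeff p (Suc j) + coeff p j) = sgn (coeff p j)"
    if "j \<le> degree p" for j
    by (rule sgn_eventually_eq[OF _ nz[OF that]]) (auto intro!: tendsto_eq_intros)
  then have "\<forall>\<^sub>F e in at_right 0. \<forall>j \<in> {..degree p}.
      sgn (e * coeff p (Suc j) + coeff p j) = sgn (coeff p j)"
    by (intro eventually_ball_finite) auto
  \<comment> \<open>This keeps \<open>e\<close> outside \<open>A\<close>, so that the new root is
    simple.\<close>
  moreover have "\<forall>\<^sub>F e in at_right (0::real). \<forall>a \<in> A. e < a"
    using A by (intro eventually_ball_finite) (auto intro!: order_tendstoD(2) tendsto_eq_intros)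
  moreover have "\<forall>\<^sub>F e in at_right (0::real). e > 0"
    by (simp add: eventually_at_right_less)
  ultimately have "\<forall>\<^sub>F e in at_right 0. e > 0 \<and> (\<forall>a \<in> A. e < a) \<and>
      (\<forall>j \<in> {..degree p}. sgn (e * coeff p (Suc j) + coeff p j) = sgn (coeff p j))"
    by eventually_elim auto
  then obtain e where e: "e > 0" "\<forall>a \<in> A. e < a"
    and e_sg: "\<And>j. j \<le> degree p \<Longrightarrow> sgn (e * coeff p (Suc j) + coeff p j) = sgn (coeff p j)"
    using eventually_happens'[OF trivial_limit_at_right_real[of 0]] by fastforce
  have eA: "e \<notin> A" using e by auto
  have eq: "two_nonreal (insert e A) u v = [:e, 1:] * p"
    using A(1) eA by (simp add: two_nonreal_insert p_def)
  have deg': "degree ([:e, 1:] * p) = degree p + 1"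
    using eq A eA degree_two_nonreal[of "insert e A" u v] deg by simp
  have "sgn (coeff ([:e, 1:] * p) j) = (if Suc q \<le> j \<and> j < Suc q + n then - 1 else 1)"
    if "j \<le> degree p + 1" for j
  proof (cases j)
    case 0
    then show ?thesis using sg[of 0] e pos by (simp add: sgn_mult)
  next
    case (Suc i)
    then show ?thesis using that sg[of i] e_sg[of i] by simp
  qed
  then have "defines_sign_pattern (two_nonreal (insert e A) u v) (Sigma_pattern m n (Suc q))"
    unfolding eq defines_Sigma_pattern_iff deg' using deg by simp
  then show ?thesis
    using A e uv pos eA
    by (auto simp: realizable_Sigma_iff intro!: exI[of _ "insert e A"])
qed

text \<open>Divided by \<open>e\<close>, coefficient \<open>j > 0\<close> of
  \<open>(x + e) p\<close> is \<open>coeff p j + coeff p (j - 1) / e\<close>, which tends to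
  \<open>coeff p j\<close> as \<open>e\<close> grows. So the old signs stay in their degrees below a
  new leading 1.\<close>

lemma realizable_Sigma_Suc_left:
  assumes pos: "m \<ge> 1" "n \<ge> 1" "q \<ge> 1" and "realizable_Sigma m n q"
  shows "realizable_Sigma (Suc m) n q"
proof -
  obtain A u v where A: "finite A" "A \<subseteq> {0<..}" "card A + 3 = m + n + q" and uv: "u\<^sup>2 < 4 * v"
    and pat: "defines_sign_pattern (two_nonreal A u v) (Sigma_pattern m n q)"
    using assms by (auto simp: realizable_Sigma_iff)
  define p where "p = two_nonreal A u v"
  have deg: "degree p + 1 = m + n + q"
    and sg: "\<And>j. j \<le> degree p \<Longrightarrow> sgn (coeff p j) = (if q \<le> j \<and> j < q + n then - 1 else 1)"
    using pat by (auto simp: defines_Sigma_pattern_iff p_def)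
  have nz: "coeff p j \<noteq> 0" if "j \<le> degree p" for j
    using sg[OF that] by (auto split: if_splits)
  \<comment> \<open>These are the coefficients of \<open>x * p\<close>; as \<open>c 0 = 0\<close>,
    the constant term fits the same formula.\<close>
  define c where "c j = coeff (pCons 0 p) j" for j
  have "\<forall>\<^sub>F e in at_top. sgn (coeff p j + c j / e) = sgn (coeff p j)"
    if "j \<le> degree p" for j
    by (rule sgn_eventually_eq[OF _ nz[OF that]])
      (rule tendsto_add[OF tendsto_const
        tendsto_divide_0[OF tendsto_const filterlim_at_top_imp_at_infinity[OF filterlim_ident]],
        of "coeff p j" "c j", simplified])
  then have "\<forall>\<^sub>F e in at_top. \<forall>j \<in> {..degree p}. sgn (coeff p j + c j / e) = sgn (coeff p j)"
    by (intro eventually_ball_finite) auto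
  moreover have "\<forall>\<^sub>F e in at_top. \<forall>a \<in> A. e > a"
    using A by (intro eventually_ball_finite) (auto intro: eventually_gt_at_top)
  moreover have "\<forall>\<^sub>F e in at_top. e > (0::real)"
    by (rule eventually_gt_at_top)
  ultimately have "\<forall>\<^sub>F e in at_top. e > 0 \<and> (\<forall>a \<in> A. e > a) \<and>
      (\<forall>j \<in> {..degree p}. sgn (coeff p j + c j / e) = sgn (coeff p j))"
    by eventually_elim auto
  then obtain e where e: "e > 0" "\<forall>a \<in> A. e > a"
    and e_sg: "\<And>j. j \<le> degree p \<Longrightarrow> sgn (coeff p j + c j / e) = sgn (coeff p j)"
    using eventually_happens'[OF trivial_limit_at_top_linorder] by fastforce
  have eA: "e \<notin> A" using e by auto
  have eq: "two_nonreal (insert e A) u v = [:e, 1:] * p"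
    using A(1) eA by (simp add: two_nonreal_insert p_def)
  have deg': "degree ([:e, 1:] * p) = degree p + 1"
    using eq A eA degree_two_nonreal[of "insert e A" u v] deg by simp
  have "sgn (coeff ([:e, 1:] * p) j) = (if q \<le> j \<and> j < q + n then - 1 else 1)"
    if "j \<le> degree p + 1" for j
  proof (cases "j \<le> degree p")
    case True
    have "coeff ([:e, 1:] * p) j = e * (coeff p j + c j / e)"
      using e by (simp add: c_def field_simps)
    then show ?thesis using e e_sg[OF True] sg[OF True] by (simp add: sgn_mult)
  next
    case False
    \<comment> \<open>Here the limit says nothing, since \<open>coeff p j = 0\<close>; the
      coefficient is the leading 1, above the block of minuses.\<close>
    then have j: "j = degree p + 1" using that by simp
    then have "coeff ([:e, 1:] * p) j = 1"
      using lead_coeff_two_nonreal[of "insert e A" u v] by (simp only: eq deg')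
    moreover have "\<not> j < q + n" using j deg pos by simp
    ultimately show ?thesis by (simp del: mult_pCons_left)
  qed
  then have "defines_sign_pattern (two_nonreal (insert e A) u v) (Sigma_pattern (Suc m) n q)"
    unfolding eq defines_Sigma_pattern_iff deg' using deg by simp
  then show ?thesis
    using A e uv pos eA
    by (auto simp: realizable_Sigma_iff intro!: exI[of _ "insert e A"])
qed

lemma realizable_Sigma_mono:
  assumes "realizable_Sigma m n q" "m \<ge> 1" "n \<ge> 1" "q \<ge> 1" "m \<le> m'" "q \<le> q'"
  shows "realizable_Sigma m' n q'"
proof -
  have "realizable_Sigma m' n q"
    using \<open>m \<le> m'\<close> by (induction rule: dec_induct) (use assms in \<open>auto intro: realizable_Sigma_Suc_left\<close>)
  with \<open>q \<le> q'\<close> show ?thesis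
    by (induction rule: dec_induct) (use assms in \<open>auto intro: realizable_Sigma_Suc_right\<close>)
qed

section \<open>Explicit realizations\<close>

text \<open>A list of root moduli makes the coefficients computable by simplification.
  \<open>coeffs\<close> ascends, so the pattern appears reversed.\<close>

lemma realizable_SigmaI:
  fixes u v :: real and as :: "real list"
  assumes "u\<^sup>2 < 4 * v" "distinct as" "set as \<subseteq> {0<..}" "m \<ge> 1" "n \<ge> 1" "q \<ge> 1"
    and len: "length as + 3 = m + n + q"
    and sg: "map sgn (coeffs ([:v, - u, 1:] * (\<Prod>a\<leftarrow>as. [:a, 1:])))
        = replicate q 1 @ replicate n (- 1) @ replicate m 1"
  shows "realizable_Sigma m n q"
proof -
  have eq: "[:v, - u, 1:] * (\<Prod>a\<leftarrow>as. [:a, 1:]) = two_nonreal (set as) u v" (is "_ = ?p")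
    using \<open>distinct as\<close> by (simp add: two_nonreal_def prod.distinct_set_conv_list)
  have deg: "degree ?p + 1 = m + n + q"
    using len \<open>distinct as\<close> by (simp add: degree_two_nonreal distinct_card)
  have "sgn (coeff ?p j) = (if q \<le> j \<and> j < q + n then - 1 else 1)" if "j \<le> degree ?p" for j
  proof -
    have "sgn (coeff ?p j) = map sgn (coeffs ?p) ! j"
      using that by (simp add: coeffs_nth length_coeffs_degree two_nonreal_neq_0)
    then show ?thesis using that deg by (auto simp: sg[unfolded eq] nth_append)
  qed
  then have "defines_sign_pattern ?p (Sigma_pattern m n q)"
    using deg by (simp add: defines_Sigma_pattern_iff)
  then show ?thesis
    using assms by (auto simp: realizable_Sigma_iff distinct_card intro!: exI[of _ "set as"])
qed

lemma realizable_Sigma_1_1_1: "realizable_Sigma 1 1 1"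
  by (rule realizable_SigmaI[of 1 1 "[]"]) simp_all

text \<open>Here and in the examples below \<open>v = (u / 2)\<^sup>2 + 1\<close>: the non-real pair
  has real part \<open>u / 2\<close> and imaginary parts 1 and -1.\<close>

lemma realizable_Sigma_1_2_1: "realizable_Sigma 1 2 1"
  by (rule realizable_SigmaI[of 4 5 "[3]"]) (simp_all add: numeral_eq_Suc)

text \<open>As \<open>(1, 3, 1)\<close> is impossible, the case \<open>n = 3\<close> starts from its
  two neighbours, this one and \<open>(2, 3, 1)\<close>.\<close>

lemma realizable_Sigma_1_3_2: "realizable_Sigma 1 3 2"
  by (rule realizable_SigmaI[of 10 26 "[2, 3, 4]"]) (simp_all add: eval_nat_numeral)

lemma realizable_Sigma_2_3_1: "realizable_Sigma 2 3 1"
  by (rule realizable_SigmaI[of 6 10 "[4, 5, 7]"]) (simp_all add: eval_nat_numeral)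

text \<open>For \<open>n = 4\<close>, \<open>d >= 10\<close> means \<open>m + q >= 7\<close>; with
  \<open>m, q >= 3\<close> the minimal cases are this one and \<open>(4, 4, 3)\<close>.\<close>

lemma realizable_Sigma_3_4_4: "realizable_Sigma 3 4 4"
  by (rule realizable_SigmaI[of 34 290 "[2, 11, 15, 16, 17, 18, 19, 20]"])
    (simp_all add: eval_nat_numeral)

lemma realizable_Sigma_4_4_3: "realizable_Sigma 4 4 3"
  by (rule realizable_SigmaI[of 22 122 "[8, 9, 10, 11, 13, 15, 27, 41]"])
    (simp_all add: eval_nat_numeral)

lemma realizable_Sigma_2_4_6: "realizable_Sigma 2 4 6"
  by (rule realizable_SigmaI[of 48 577 "[4, 6, 8, 10, 11, 12, 14, 15, 16]"])
    (simp_all add: eval_nat_numeral)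

section \<open>Impossibility\<close>

text \<open>
  In terms of the power sums \<open>p\<^sub>k\<close> of \<open>A\<close>, the last expression is
  \<open>(p\<^sub>1\<^sup>2 p\<^sub>2 + p\<^sub>2\<^sup>2 - 2 p\<^sub>4) / 2\<close>, which explains why it is nonnegative.
\<close>
lemma elementary_symmetric_ineqs:
  fixes A :: "real set"
  assumes "finite A" "A \<subseteq> {0<..}"
  defines "e \<equiv> coeff (\<Prod>a\<in>A. [:1, a:])"
  shows "e 0 = 1 \<and> e 1 \<ge> 0 \<and> e 2 \<ge> 0 \<and> 2 * e 2 \<le> e 1 * e 1 \<and> 2 * e 3 \<le> e 1 * e 2 \<and>
    e 1 * e 1 * e 2 - 4 * e 1 * e 3 + 4 * e 4 \<ge> 0"
  using assms(1,2) unfolding e_def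
proof (induction A rule: finite_induct)
  case empty
  then show ?case by simp
next
  case (insert a A)
  define e where "e = coeff (\<Prod>a\<in>A. [:1, a:])"
  define f where "f = coeff (\<Prod>a\<in>insert a A. [:1, a:])"
  have f: "f 0 = e 0" "f 1 = e 1 + a * e 0" "f 2 = e 2 + a * e 1" "f 3 = e 3 + a * e 2"
    "f 4 = e 4 + a * e 3"
    using insert.hyps by (simp_all add: e_def f_def eval_nat_numeral)
  have a: "a > 0" using insert.prems by simp
  have IH: "e 0 = 1" "e 1 \<ge> 0" "e 2 \<ge> 0" "2 * e 2 \<le> e 1 * e 1" "2 * e 3 \<le> e 1 * e 2"
    "e 1 * e 1 * e 2 - 4 * e 1 * e 3 + 4 * e 4 \<ge> 0"
    using insert.IH insert.prems by (auto simp: e_def)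
  have "f 0 = 1" "f 1 \<ge> 0" "f 2 \<ge> 0" using f IH a by simp_all
  moreover have "f 1 * f 1 - 2 * f 2 = (e 1 * e 1 - 2 * e 2) + a * a"
    using f IH(1) by (simp add: algebra_simps)
  then have "2 * f 2 \<le> f 1 * f 1" using IH(4) zero_le_square[of a] by linarith
  \<comment> \<open>The middle coefficient is nonnegative because
    \<open>e 1 * e 1 >= 2 * e 2 >= e 2\<close>.\<close>
  moreover have "f 1 * f 2 - 2 * f 3
      = (e 1 * e 2 - 2 * e 3) + a * (e 1 * e 1 - e 2) + a * a * e 1"
    using f IH(1) by (simp add: algebra_simps)
  moreover have "a * (e 1 * e 1 - e 2) \<ge> 0" "a * a * e 1 \<ge> 0"
    using IH(2,3,4) a by simp_all
  ultimately have part: "f 0 = 1" "f 1 \<ge> 0" "f 2 \<ge> 0" "2 * f 2 \<le> f 1 * f 1" "2 * f 3 \<le> f 1 * f 2"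
    using IH(5) by linarith+
  \<comment> \<open>The terms with \<open>a * e 3\<close> cancel. The other powers of
    \<open>a\<close> have nonnegative coefficients, since
    \<open>2 * e 2 \<le> e 1 * e 1\<close>.\<close>
  have "f 1 * f 1 * f 2 - 4 * f 1 * f 3 + 4 * f 4
      = (e 1 * e 1 * e 2 - 4 * e 1 * e 3 + 4 * e 4) + a * (e 1 * (e 1 * e 1 - 2 * e 2))
        + a * a * (2 * (e 1 * e 1) - 3 * e 2) + a * a * a * e 1"
    using f IH(1) by (simp add: algebra_simps)
  moreover have "a * (e 1 * (e 1 * e 1 - 2 * e 2)) \<ge> 0" "a * a * (2 * (e 1 * e 1) - 3 * e 2) \<ge> 0"
    "a * a * a * e 1 \<ge> 0"
    using IH(2,3,4) a by simp_all
  ultimately have "f 1 * f 1 * f 2 - 4 * f 1 * f 3 + 4 * f 4 \<ge> 0" using IH(6) by linarith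
  then show ?case using part unfolding f_def by blast
qed

text \<open>Reversing the polynomial turns \<open>x + a\<close> into \<open>1 + a x\<close>, so the
  coefficients counted from the top become combinations of elementary symmetric functions whose
  indices do not involve \<open>card A\<close>.\<close>

lemma coeff_two_nonreal:
  assumes "finite A" "k \<le> card A + 2"
  shows "coeff (two_nonreal A u v) (card A + 2 - k)
    = coeff ([:1, - u, v:] * (\<Prod>a\<in>A. [:1, a:])) k"
proof -
  have quad: "reflect_poly [:v, - u, 1:] = [:1, - u, v:]"
    by (simp add: reflect_poly_def)
  have lin: "reflect_poly [:a, 1:] = [:1, a:]" for a :: real
    by (simp add: reflect_poly_def)
  have "reflect_poly (two_nonreal A u v) = [:1, - u, v:] * (\<Prod>a\<in>A. [:1, a:])"
    unfolding two_nonreal_def reflect_poly_mult reflect_poly_prod quad lin ..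
  moreover have "coeff (reflect_poly (two_nonreal A u v)) k
      = coeff (two_nonreal A u v) (card A + 2 - k)"
    using assms by (simp add: coeff_reflect_poly degree_two_nonreal)
  ultimately show ?thesis by simp
qed

lemma not_realizable_Sigma_1:
  assumes "n \<ge> 4" "q \<ge> 1"
  shows "\<not> realizable_Sigma 1 n q"
proof
  assume "realizable_Sigma 1 n q"
  then obtain A u v where A: "finite A" "A \<subseteq> {0<..}" "card A + 2 = n + q" and uv: "u\<^sup>2 < 4 * v"
    and pat: "defines_sign_pattern (two_nonreal A u v) (Sigma_pattern 1 n q)"
    using assms by (auto simp: realizable_Sigma_iff)
  define e where "e = coeff (\<Prod>a\<in>A. [:1, a:])"
  \<comment> \<open>Counted from the top, starting at 0, the minuses occupy the positions 1 to
    \<open>n\<close>, which include 4.\<close>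
  have "coeff ([:1, - u, v:] * (\<Prod>a\<in>A. [:1, a:])) k < 0" if "k = 1 \<or> k = 4" for k
  proof -
    have "sgn (coeff (two_nonreal A u v) (card A + 2 - k)) = - 1"
      using pat that A assms by (auto simp: defines_Sigma_pattern_iff degree_two_nonreal)
    then have "coeff (two_nonreal A u v) (card A + 2 - k) < 0"
      by (simp add: sgn_if split: if_splits)
    then show ?thesis using that A assms by (subst (asm) coeff_two_nonreal) auto
  qed
  from this[of 1] this[of 4] have neg: "e 1 - u * e 0 < 0" "e 4 - u * e 3 + v * e 2 < 0"
    by (simp_all add: e_def eval_nat_numeral)
  have e: "e 0 = 1" "e 1 \<ge> 0" "e 2 \<ge> 0" "2 * e 3 \<le> e 1 * e 2"
    "e 1 * e 1 * e 2 - 4 * e 1 * e 3 + 4 * e 4 \<ge> 0"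
    using elementary_symmetric_ineqs[OF A(1,2)] by (auto simp: e_def)
  have u: "e 1 < u" using neg(1) e(1) by simp
  \<comment> \<open>By this, four times the fifth coefficient is at least
    \<open>u * u * e 2 - 4 * u * e 3 + 4 * e 4\<close>, which is then compared with its value at
    \<open>u = e 1\<close>.\<close>
  have "u * u * e 2 \<le> 4 * v * e 2"
    using uv e(3) by (intro mult_right_mono) (auto simp: power2_eq_square)
  moreover have "u * u * e 2 - 4 * u * e 3 + 4 * e 4
      = (e 1 * e 1 * e 2 - 4 * e 1 * e 3 + 4 * e 4) + (u - e 1) * ((u + e 1) * e 2 - 4 * e 3)"
    by (simp add: algebra_simps)
  moreover have "e 1 * e 2 \<le> u * e 2" using u e(3) by (intro mult_right_mono) auto
  then have "(u + e 1) * e 2 - 4 * e 3 \<ge> 0"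
    using e(4) by (simp add: algebra_simps)
  then have "(u - e 1) * ((u + e 1) * e 2 - 4 * e 3) \<ge> 0" using u by simp
  ultimately show False using neg(2) e(5) by (simp add: algebra_simps)
qed

text \<open>Now the fifth coefficient is positive, so the fourth takes its place. Combined with
  \<open>u\<^sup>2 < 4 * v\<close> it gives \<open>u * (a + b) < 4 * (a * b)\<close>, and
  \<open>u > a + b\<close> then contradicts the inequality of arithmetic and geometric
  means.\<close>

lemma not_realizable_Sigma_1_3_1: "\<not> realizable_Sigma 1 3 1"
proof
  assume "realizable_Sigma 1 3 1"
  then obtain A u v where A: "finite A" "A \<subseteq> {0<..}" "card A = 2" and uv: "u\<^sup>2 < 4 * v"
    and pat: "defines_sign_pattern (two_nonreal A u v) (Sigma_pattern 1 3 1)"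
    by (auto simp: realizable_Sigma_iff)
  obtain a b where ab: "A = {a, b}" "a \<noteq> b" using A(3) by (auto simp: card_2_iff)
  have pos: "a > 0" "b > 0" using A(2) ab by auto
  have "coeff ([:1, - u, v:] * (\<Prod>a\<in>A. [:1, a:])) k < 0" if "k = 1 \<or> k = 3" for k
  proof -
    have "sgn (coeff (two_nonreal A u v) (card A + 2 - k)) = - 1"
      using pat that A by (auto simp: defines_Sigma_pattern_iff degree_two_nonreal)
    then have "coeff (two_nonreal A u v) (card A + 2 - k) < 0"
      by (simp add: sgn_if split: if_splits)
    then show ?thesis using that A by (subst (asm) coeff_two_nonreal) auto
  qed
  from this[of 1] this[of 3] have u: "a + b < u" and neg: "v * (a + b) < u * (a * b)"
    using ab by (simp_all add: eval_nat_numeral algebra_simps)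
  have "u * (u * (a + b)) \<le> 4 * (v * (a + b))"
    using uv pos by (simp add: power2_eq_square flip: mult.assoc)
  also have "\<dots> < u * (4 * (a * b))" using neg by simp
  finally have "u * (a + b) < 4 * (a * b)"
    using u pos by (simp add: mult_less_cancel_left)
  moreover have "(a + b) * (a + b) \<le> u * (a + b)"
    using u pos by (intro mult_right_mono) auto
  moreover have "(a + b) * (a + b) - 4 * (a * b) = (a - b) * (a - b)"
    by (simp add: algebra_simps)
  ultimately show False using zero_le_square[of "a - b"] by linarith
qed

theorem theorem1:
  fixes m n q d :: nat
  assumes "m \<ge> 1" and "n \<ge> 1" and "q \<ge> 1" and "d = m + n + q - 1"
  shows
    "((n = 1 \<and> d \<ge> 2) \<or> (n = 2 \<and> d \<ge> 3) \<longrightarrow> realizable (Sigma_pattern m n q) (0, d - 2)) \<and>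
     (n = 3 \<and> d \<ge> 5 \<longrightarrow> realizable (Sigma_pattern m 3 q) (0, d - 2)) \<and>
     \<not> realizable (Sigma_pattern 1 3 1) (0, 2) \<and>
     (n = 4 \<and> ((q \<ge> 3 \<and> m \<ge> 3 \<and> d \<ge> 10) \<or> (m = 2 \<and> q \<ge> 6)) \<longrightarrow>
        realizable (Sigma_pattern m 4 q) (0, d - 2)) \<and>
     (m = 1 \<and> n \<ge> 4 \<longrightarrow> \<not> realizable (Sigma_pattern 1 n q) (0, d - 2))"
proof -
  have d: "d - 2 = m + n + q - 3" using assms by simp
  have real: "realizable (Sigma_pattern m n q) (0, d - 2) \<longleftrightarrow> realizable_Sigma m n q"
    by (simp add: realizable_Sigma_def d)
  have "realizable_Sigma m n q" if "n = 1 \<or> n = 2"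
    using that realizable_Sigma_mono[OF realizable_Sigma_1_1_1, of m q]
      realizable_Sigma_mono[OF realizable_Sigma_1_2_1, of m q] assms by auto
  moreover have "realizable_Sigma m n q" if "n = 3" "d \<ge> 5"
  proof (cases "q \<ge> 2")
    case True
    then show ?thesis
      using realizable_Sigma_mono[OF realizable_Sigma_1_3_2, of m q] that assms by simp
  next
    case False
    \<comment> \<open>Here \<open>q = 1\<close>, so \<open>d = m + 3\<close>.\<close>
    then have "m \<ge> 2" using that assms by simp
    then show ?thesis
      using realizable_Sigma_mono[OF realizable_Sigma_2_3_1, of m q] that assms by simp
  qed
  moreover have "realizable_Sigma m n q" if "n = 4" "q \<ge> 3" "m \<ge> 3" "d \<ge> 10"
  proof (cases "q \<ge> 4")
    case True
    then show ?thesis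
      using realizable_Sigma_mono[OF realizable_Sigma_3_4_4, of m q] that by simp
  next
    case False
    \<comment> \<open>Here \<open>q = 3\<close>, so \<open>d = m + 6\<close>.\<close>
    then have "m \<ge> 4" using that assms by simp
    then show ?thesis
      using realizable_Sigma_mono[OF realizable_Sigma_4_4_3, of m q] that by simp
  qed
  moreover have "realizable_Sigma m n q" if "n = 4" "m = 2" "q \<ge> 6"
    using realizable_Sigma_mono[OF realizable_Sigma_2_4_6, of m q] that by simp
  moreover have "\<not> realizable (Sigma_pattern 1 3 1) (0, 2)"
    using not_realizable_Sigma_1_3_1 by (simp add: realizable_Sigma_def)
  moreover have "\<not> realizable_Sigma m n q" if "m = 1" "n \<ge> 4"
    using not_realizable_Sigma_1 that assms by simp
  ultimately show ?thesis using real by blast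
qed

end
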